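(* Let $S$ be a finite state space and $L$ the generator of an ergodic continuous-time Markov chain on $S$ with transition rates $q$. Let $\Delta t\in(0,1)$, $P_{\Delta t}(\sigma,\sigma')=e^{\Delta t L}\delta_{\sigma'}(\sigma)$, and let $Q_{\Delta t}(\sigma,\sigma')$ be an approximation of $P_{\Delta t}$ based on a splitting scheme for $L=L_1+L_2$, where $L_1,L_2$ are restrictions of $L$. Let $\mu_Q$ be the stationary distribution of $Q_{\Delta t}$. Let the splitting scheme have order of the local error $p$ and commutator $C$, and define the bounded diameter $$\hat k=\min\{\mathrm{diam}(S),p\}=\min\Big\{\max_{\sigma,\sigma'\in S}d(\sigma,\sigma'),\,p\Big\}.$$ If $C(\sigma,\sigma')\neq0$ for at least one pair $\sigma,\sigma'\in S$ with $d(\sigma,\sigma')=\hat k$, then $$H(Q_{\Delta t}|P_{\Delta t})=O\big(\Delta t^{\,2p-(\hat k+1)}\big)\qquad(\Delta t\to0).$$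
   Context: Here $\delta_{\sigma'}(\sigma)=1$ if $\sigma=\sigma'$ and $0$ otherwise, and $L[f](\sigma)=\sum_{\sigma'\in S}q(\sigma,\sigma')(f(\sigma')-f(\sigma))$. Restriction: for $A\subset S\times S$, the restriction $L|_A$ is the generator $L|_A[f](\sigma)=\sum_{\sigma'\in S}q(\sigma,\sigma')\chi_A(\sigma,\sigma')(f(\sigma')-f(\sigma))$, with $\chi_A$ the characteristic function of $A$. Splitting scheme: $Q_{\Delta t}(\sigma,\sigma')=\big(e^{c_1\Delta tL_{i_1}}\cdots e^{c_m\Delta tL_{i_m}}\big)\delta_{\sigma'}(\sigma)$ with fixed $m$, $i_j\in\{1,2\}$, $c_j\ge0$, and $\sum_{j:i_j=1}c_j=\sum_{j:i_j=2}c_j=1$ (e.g. Lie: $e^{\Delta tL_1}e^{\Delta tL_2}$; Strang: $e^{\frac{\Delta t}{2}L_1}e^{\Delta tL_2}e^{\frac{\Delta t}{2}L_1}$). Expanding the exponentials gives $Q_{\Delta t}(\sigma,\sigma')=\sum_{k\ge0}\frac{\Delta t^k}{k!}L_Q^k[\delta_{\sigma'}](\sigma)$, which defines the operators $L_Q^k$ (in general $L_Q^k$ is not a $k$-th power of an operator). Order of the local error and commutator: $p$ is the smallest integer with $L^p\ne L_Q^p$ (assumed to exist; then $p>1$), and $C(\sigma,\sigma')=\frac1{p!}(L^p-L_Q^p)\delta_{\sigma'}(\sigma)$, so that $P_{\Delta t}(\sigma,\sigma')=Q_{\Delta t}(\sigma,\sigma')+C(\sigma,\sigma')\Delta t^p+o(\Delta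 t^p)$. Distance: a path of length $n$ from $\sigma$ to $\sigma'$ is a sequence $(z_0,\dots,z_n)$ of distinct states with $z_0=\sigma$, $z_n=\sigma'$ and $\prod_{i=0}^{n-1}q(z_i,z_{i+1})>0$. For $\sigma\ne\sigma'$, $d(\sigma,\sigma')$ is the minimal length of a path from $\sigma$ to $\sigma'$ ($+\infty$ if none exists), and $d(\sigma,\sigma)=0$. $d$ need not be symmetric. $\mathrm{diam}(S)=\max_{\sigma,\sigma'}d(\sigma,\sigma')$. Relative entropy rate (normalized by $\Delta t$): $$H(Q_{\Delta t}|P_{\Delta t})=\frac1{\Delta t}\sum_{\sigma,\sigma'\in S}\mu_Q(\sigma)\,Q_{\Delta t}(\sigma,\sigma')\log\frac{Q_{\Delta t}(\sigma,\sigma')}{P_{\Delta t}(\sigma,\sigma')},$$ with the convention $0\log 0=0$. *)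

theory Defs
  imports "HOL-Analysis.Analysis" "HOL-Library.Extended_Nat" "HOL-Library.Landau_Symbols"
begin

text \<open>
  The finite state space is a type of class \<open>finite\<close>; observables are functions
  \<open>'a \<Rightarrow> real\<close>. Diagonal values \<open>q x x\<close> do not influence anything below
  and are left unconstrained.
\<close>

type_synonym 'a observable = "'a \<Rightarrow> real"

definition rates :: "('a::finite \<Rightarrow> 'a \<Rightarrow> real) \<Rightarrow> bool" where
  "rates q \<longleftrightarrow> (\<forall>x y. x \<noteq> y \<longrightarrow> q x y \<ge> 0)"

definition generator :: "('a::finite \<Rightarrow> 'a \<Rightarrow> real) \<Rightarrow> 'a observable \<Rightarrow> 'a observable" where
  "generator q f x = (\<Sum>y\<in>UNIV. q x y * (f y - f x))"

definition restriction ::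
    "('a::finite \<Rightarrow> 'a \<Rightarrow> real) \<Rightarrow> ('a \<times> 'a) set \<Rightarrow> 'a observable \<Rightarrow> 'a observable" where
  "restriction q A f x = (\<Sum>y\<in>UNIV. q x y * indicator A (x, y) * (f y - f x))"

text \<open>
  Ergodicity of a continuous-time chain means irreducibility together with positive
  recurrence. On a finite state space the latter follows from the former, and a
  continuous-time chain has no periodicity, so only irreducibility is recorded.
\<close>

definition ergodic :: "('a::finite \<Rightarrow> 'a \<Rightarrow> real) \<Rightarrow> bool" where
  "ergodic q \<longleftrightarrow> (\<forall>x y. (x, y) \<in> {(u, v). q u v > 0}\<^sup>*)"

definition kdelta :: "'a \<Rightarrow> 'a observable" where
  "kdelta y x = (if x = y then 1 else 0)"

text \<open>The exponential series of \<open>t L\<close>, evaluated pointwise; it converges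
  for every linear operator because the state space is finite (\<open>op_exp_sums\<close> below).\<close>

definition op_exp ::
    "real \<Rightarrow> ('a observable \<Rightarrow> 'a observable) \<Rightarrow> 'a observable \<Rightarrow> 'a observable" where
  "op_exp t L f x = (\<Sum>n. t ^ n / fact n * (L ^^ n) f x)"

definition transition :: "('a observable \<Rightarrow> 'a observable) \<Rightarrow> real \<Rightarrow> 'a \<Rightarrow> 'a \<Rightarrow> real" where
  "transition L t x y = op_exp t L (kdelta y) x"

text \<open>
  A splitting scheme is the list \<open>[(i\<^sub>1, c\<^sub>1), \<dots>, (i\<^sub>m, c\<^sub>m)]\<close>. The first entry is the
  outermost (leftmost) exponential.
\<close>

type_synonym scheme = "(nat \<times> real) list"

definition splitting_scheme :: "scheme \<Rightarrow> bool" where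
  "splitting_scheme s \<longleftrightarrow>
     (\<forall>(i, c) \<in> set s. i \<in> {1, 2} \<and> c \<ge> 0) \<and>
     (\<forall>i \<in> {1, 2}. (\<Sum>(j, c) \<leftarrow> filter (\<lambda>(j, c). j = i) s. c) = 1)"

definition pair_op ::
    "('a observable \<Rightarrow> 'a observable) \<Rightarrow> ('a observable \<Rightarrow> 'a observable)
      \<Rightarrow> nat \<Rightarrow> 'a observable \<Rightarrow> 'a observable" where
  "pair_op L1 L2 i = (if i = 1 then L1 else L2)"

fun scheme_op ::
    "(nat \<Rightarrow> 'a observable \<Rightarrow> 'a observable) \<Rightarrow> scheme \<Rightarrow> real
      \<Rightarrow> 'a observable \<Rightarrow> 'a observable" where
  "scheme_op M [] t f = f"
| "scheme_op M ((i, c) # s) t f = op_exp (c * t) (M i) (scheme_op M s t f)"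

definition scheme_transition ::
    "(nat \<Rightarrow> 'a observable \<Rightarrow> 'a observable) \<Rightarrow> scheme \<Rightarrow> real \<Rightarrow> 'a \<Rightarrow> 'a \<Rightarrow> real" where
  "scheme_transition M s t x y = scheme_op M s t (kdelta y) x"

text \<open>
  \<open>scheme_coeff M s k\<close> is the operator \<open>L\<^sub>Q\<^sup>k\<close>, i.e. \<open>k!\<close> times the coefficient of \<open>t\<^sup>k\<close>
  in the product of the exponential series; the recursion is the Cauchy product with the
  series of the outermost factor. That this is the expansion of the scheme is the lemma
  \<open>scheme_transition_expansion\<close>.
\<close>

fun scheme_coeff ::
    "(nat \<Rightarrow> 'a observable \<Rightarrow> 'a observable) \<Rightarrow> scheme \<Rightarrow> nat
      \<Rightarrow> 'a observable \<Rightarrow> 'a observable" where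
  "scheme_coeff M [] k f = (if k = 0 then f else (\<lambda>x. 0))"
| "scheme_coeff M ((i, c) # s) k f =
     (\<lambda>x. \<Sum>j\<le>k. real (k choose j) * c ^ j * (M i ^^ j) (scheme_coeff M s (k - j) f) x)"

definition local_error_order ::
    "('a observable \<Rightarrow> 'a observable) \<Rightarrow> (nat \<Rightarrow> 'a observable \<Rightarrow> 'a observable)
      \<Rightarrow> nat \<Rightarrow> bool" where
  "local_error_order L LQ p \<longleftrightarrow> L ^^ p \<noteq> LQ p \<and> (\<forall>k<p. L ^^ k = LQ k)"

definition commutator ::
    "('a observable \<Rightarrow> 'a observable) \<Rightarrow> (nat \<Rightarrow> 'a observable \<Rightarrow> 'a observable)
      \<Rightarrow> nat \<Rightarrow> 'a \<Rightarrow> 'a \<Rightarrow> real" where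
  "commutator L LQ p x y = 1 / fact p * ((L ^^ p) (kdelta y) x - LQ p (kdelta y) x)"

definition is_path :: "('a \<Rightarrow> 'a \<Rightarrow> real) \<Rightarrow> nat \<Rightarrow> 'a \<Rightarrow> 'a \<Rightarrow> 'a list \<Rightarrow> bool" where
  "is_path q n x y zs \<longleftrightarrow>
     length zs = n + 1 \<and> distinct zs \<and> zs ! 0 = x \<and> zs ! n = y \<and>
     (\<Prod>i<n. q (zs ! i) (zs ! (i + 1))) > 0"

definition path_dist :: "('a \<Rightarrow> 'a \<Rightarrow> real) \<Rightarrow> 'a \<Rightarrow> 'a \<Rightarrow> enat" where
  "path_dist q x y = (if x = y then 0 else Inf {enat n | n. \<exists>zs. is_path q n x y zs})"

definition path_diam :: "('a::finite \<Rightarrow> 'a \<Rightarrow> real) \<Rightarrow> enat" where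
  "path_diam q = Max {path_dist q x y | x y. True}"

definition stationary_distribution :: "('a::finite \<Rightarrow> 'a \<Rightarrow> real) \<Rightarrow> 'a observable \<Rightarrow> bool" where
  "stationary_distribution K \<mu> \<longleftrightarrow>
     (\<forall>x. \<mu> x \<ge> 0) \<and> (\<Sum>x\<in>UNIV. \<mu> x) = 1 \<and> (\<forall>y. (\<Sum>x\<in>UNIV. \<mu> x * K x y) = \<mu> y)"

text \<open>The convention \<open>0 log 0 = 0\<close> is automatic, as \<open>0 * z = 0\<close> for every real \<open>z\<close>.\<close>

definition rel_entropy_rate ::
    "real \<Rightarrow> 'a observable \<Rightarrow> ('a::finite \<Rightarrow> 'a \<Rightarrow> real) \<Rightarrow> ('a \<Rightarrow> 'a \<Rightarrow> real) \<Rightarrow> real" where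
  "rel_entropy_rate t \<mu> Q P =
     1 / t * (\<Sum>x\<in>UNIV. \<Sum>y\<in>UNIV. \<mu> x * Q x y * ln (Q x y / P x y))"


subsection \<open>The series expansion of a splitting scheme\<close>

definition has_matrix :: "('a::finite observable \<Rightarrow> 'a observable) \<Rightarrow> bool" where
  "has_matrix L \<longleftrightarrow> (\<exists>K. \<forall>f x. L f x = (\<Sum>y\<in>UNIV. K x y * f y))"

lemma has_matrix_restriction: "has_matrix (restriction q A)"
proof -
  define D where "D x = (\<Sum>z\<in>UNIV. q x z * indicator A (x, z))" for x
  define K where "K x y = q x y * indicator A (x, y) - (if y = x then D x else 0)" for x y
  have "restriction q A f x = (\<Sum>y\<in>UNIV. K x y * f y)" for f x
  proof -
    have "(\<Sum>y\<in>UNIV. (if y = x then D x else 0) * f y)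
        = (\<Sum>y\<in>UNIV. if y = x then D x * f y else 0)"
      by (intro sum.cong) auto
    also have "\<dots> = D x * f x"
      by simp
    finally show ?thesis
      by (simp only: restriction_def K_def D_def right_diff_distrib left_diff_distrib
          sum_subtractf sum_distrib_right)
  qed
  then have "\<forall>f x. restriction q A f x = (\<Sum>y\<in>UNIV. K x y * f y)"
    by (intro allI)
  then show ?thesis
    unfolding has_matrix_def by (rule exI[where x = K])
qed

lemma generator_eq_restriction: "generator q = restriction q UNIV"
  by (intro ext) (simp add: generator_def restriction_def)

lemma has_matrix_generator: "has_matrix (generator q)"
  by (simp add: generator_eq_restriction has_matrix_restriction)

lemma has_matrix_funpow:
  assumes "has_matrix L"
  shows "(L ^^ n) f x = (\<Sum>y\<in>UNIV. (L ^^ n) (kdelta y) x * f y)"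
proof -
  from assms obtain K where K: "\<And>f x. L f x = (\<Sum>y\<in>UNIV. K x y * f y)"
    unfolding has_matrix_def by blast
  show ?thesis
  proof (induction n arbitrary: x)
    case 0
    have "(\<Sum>y\<in>UNIV. kdelta y x * f y) = (\<Sum>y\<in>UNIV. if y = x then f y else 0)"
      by (intro sum.cong) (auto simp: kdelta_def)
    then show ?case by simp
  next
    case (Suc n)
    have "(L ^^ Suc n) f x = (\<Sum>z\<in>UNIV. K x z * (\<Sum>y\<in>UNIV. (L ^^ n) (kdelta y) z * f y))"
      by (simp only: funpow.simps o_apply K[of "(L ^^ n) f" x] Suc.IH[symmetric])
    also have "\<dots> = (\<Sum>z\<in>UNIV. \<Sum>y\<in>UNIV. K x z * (L ^^ n) (kdelta y) z * f y)"
      by (simp add: sum_distrib_left mult.assoc)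
    also have "\<dots> = (\<Sum>y\<in>UNIV. \<Sum>z\<in>UNIV. K x z * (L ^^ n) (kdelta y) z * f y)"
      by (rule sum.swap)
    also have "\<dots> = (\<Sum>y\<in>UNIV. (L ^^ Suc n) (kdelta y) x * f y)"
      by (simp only: funpow.simps o_apply K[of "(L ^^ n) (kdelta _)" x] sum_distrib_right)
    finally show ?case .
  qed
qed

lemma op_exp_summable_norm:
  assumes "has_matrix L"
  shows "summable (\<lambda>n. norm (t ^ n / fact n * (L ^^ n) f x))"
proof -
  from assms obtain K where K: "\<And>f x. L f x = (\<Sum>y\<in>UNIV. K x y * f y)"
    unfolding has_matrix_def by blast
  define b where "b = (\<Sum>x\<in>UNIV. \<Sum>y\<in>UNIV. \<bar>K x y\<bar>)"
  define B where "B = (\<Sum>x\<in>UNIV. \<bar>f x\<bar>)"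
  have bound: "\<bar>(L ^^ n) f x\<bar> \<le> b ^ n * B" for n x
  proof (induction n arbitrary: x)
    case 0
    then show ?case unfolding B_def
      by (auto intro: member_le_sum[of x UNIV "\<lambda>x. \<bar>f x\<bar>"])
  next
    case (Suc n)
    have "\<bar>(L ^^ Suc n) f x\<bar> \<le> (\<Sum>y\<in>UNIV. \<bar>K x y * (L ^^ n) f y\<bar>)"
      by (simp only: funpow.simps o_apply K[of "(L ^^ n) f" x] sum_abs)
    also have "\<dots> \<le> (\<Sum>y\<in>UNIV. \<bar>K x y\<bar> * (b ^ n * B))"
      by (intro sum_mono) (auto simp: abs_mult intro: mult_left_mono Suc.IH)
    also have "\<dots> = (\<Sum>y\<in>UNIV. \<bar>K x y\<bar>) * (b ^ n * B)"
      by (simp add: sum_distrib_right)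
    also have "\<dots> \<le> b * (b ^ n * B)"
    proof (rule mult_right_mono)
      show "(\<Sum>y\<in>UNIV. \<bar>K x y\<bar>) \<le> b"
        unfolding b_def by (rule member_le_sum) (auto intro: sum_nonneg)
      show "0 \<le> b ^ n * B"
        unfolding b_def B_def by (intro mult_nonneg_nonneg zero_le_power sum_nonneg) auto
    qed
    finally show ?case by (simp add: mult.assoc)
  qed
  have "summable (\<lambda>n. B * (inverse (fact n) * (\<bar>t\<bar> * b) ^ n))"
    by (intro summable_mult summable_exp)
  then show ?thesis
  proof (rule summable_comparison_test[rotated], intro exI allI impI)
    fix n
    have "\<bar>t\<bar> ^ n / fact n * \<bar>(L ^^ n) f x\<bar> \<le> \<bar>t\<bar> ^ n / fact n * (b ^ n * B)"
      by (intro mult_left_mono bound) auto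
    then show "norm (norm (t ^ n / fact n * (L ^^ n) f x))
        \<le> B * (inverse (fact n) * (\<bar>t\<bar> * b) ^ n)"
      by (simp add: abs_mult power_abs field_simps)
  qed
qed

lemma op_exp_sums:
  assumes "has_matrix L"
  shows "(\<lambda>n. t ^ n / fact n * (L ^^ n) f x) sums op_exp t L f x"
  unfolding op_exp_def
  by (rule summable_sums[OF summable_norm_cancel[OF op_exp_summable_norm[OF assms]]])

lemma op_exp_matrix:
  assumes "has_matrix L"
  shows "op_exp t L f x = (\<Sum>y\<in>UNIV. op_exp t L (kdelta y) x * f y)"
proof -
  have "(\<lambda>n. \<Sum>y\<in>UNIV. t ^ n / fact n * (L ^^ n) (kdelta y) x * f y) sums
      (\<Sum>y\<in>UNIV. op_exp t L (kdelta y) x * f y)"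
    by (intro sums_sum sums_mult2 op_exp_sums assms)
  also have "(\<lambda>n. \<Sum>y\<in>UNIV. t ^ n / fact n * (L ^^ n) (kdelta y) x * f y)
      = (\<lambda>n. t ^ n / fact n * (L ^^ n) f x)"
    by (subst (2) has_matrix_funpow[OF assms]) (simp add: sum_distrib_left mult.assoc)
  finally show ?thesis
    using op_exp_sums[OF assms] sums_unique2 by blast
qed

lemma scheme_op_expansion:
  fixes M :: "nat \<Rightarrow> ('a::finite) observable \<Rightarrow> 'a observable"
  assumes M: "\<And>i. has_matrix (M i)"
  shows "summable (\<lambda>k. norm (t ^ k / fact k * scheme_coeff M s k f x)) \<and>
         (\<lambda>k. t ^ k / fact k * scheme_coeff M s k f x) sums scheme_op M s t f x"
proof (induction s arbitrary: x)
  case Nil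
  have *: "t ^ k / fact k * scheme_coeff M [] k f x = (if k = 0 then f x else 0)" for k
    by auto
  have "summable (\<lambda>k. norm (if k = 0 then f x else (0::real)))"
    by (rule summable_finite[of "{0}"]) auto
  moreover have "(\<lambda>k. if k = 0 then f x else 0) sums f x"
    using sums_single[of 0 "\<lambda>_. f x"] by simp
  ultimately show ?case by (simp only: * scheme_op.simps simp_thms)
next
  case (Cons ic s)
  obtain i c where ic: "ic = (i, c)" by (cases ic)
  define a where "a y n = (c * t) ^ n / fact n * (M i ^^ n) (kdelta y) x" for y n
  define e where "e y k = t ^ k / fact k * scheme_coeff M s k f y" for y k
  have a_abs: "summable (\<lambda>n. norm (a y n))" for y
    unfolding a_def by (rule op_exp_summable_norm[OF M])
  have a_sum: "a y sums op_exp (c * t) (M i) (kdelta y) x" for y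
    unfolding a_def by (rule op_exp_sums[OF M])
  have e_abs: "summable (\<lambda>k. norm (e y k))" and e_sum: "e y sums scheme_op M s t f y" for y
    unfolding e_def using Cons.IH[of y] by blast+
  have coeff: "t ^ k / fact k * scheme_coeff M (ic # s) k f x
      = (\<Sum>y\<in>UNIV. \<Sum>j\<le>k. a y j * e y (k - j))" for k
  proof -
    have coeff_summand: "t ^ k / fact k * (real (k choose j) * c ^ j *
          ((M i ^^ j) (kdelta y) x * scheme_coeff M s (k - j) f y)) = a y j * e y (k - j)"
      if "j \<le> k" for j y
    proof -
      have "t ^ k = t ^ j * t ^ (k - j)"
        using that by (simp flip: power_add)
      then show ?thesis
        using that by (simp add: a_def e_def binomial_fact power_mult_distrib)
    qed
    have "t ^ k / fact k * scheme_coeff M (ic # s) k f x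
        = (\<Sum>j\<le>k. \<Sum>y\<in>UNIV. t ^ k / fact k * (real (k choose j) * c ^ j *
            ((M i ^^ j) (kdelta y) x * scheme_coeff M s (k - j) f y)))"
      unfolding ic scheme_coeff.simps
      by (subst has_matrix_funpow[OF M]) (simp only: sum_distrib_left)
    also have "\<dots> = (\<Sum>j\<le>k. \<Sum>y\<in>UNIV. a y j * e y (k - j))"
      by (intro sum.cong refl coeff_summand) auto
    also have "\<dots> = (\<Sum>y\<in>UNIV. \<Sum>j\<le>k. a y j * e y (k - j))"
      by (rule sum.swap)
    finally show ?thesis .
  qed
  have "(\<lambda>k. \<Sum>j\<le>k. a y j * e y (k - j)) sums
      (op_exp (c * t) (M i) (kdelta y) x * scheme_op M s t f y)" for y
    using Cauchy_product_sums[OF a_abs[of y] e_abs[of y]] a_sum[of y] e_sum[of y]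
    by (simp add: sums_unique[symmetric])
  then have "(\<lambda>k. \<Sum>y\<in>UNIV. \<Sum>j\<le>k. a y j * e y (k - j)) sums
      (\<Sum>y\<in>UNIV. op_exp (c * t) (M i) (kdelta y) x * scheme_op M s t f y)"
    by (intro sums_sum)
  moreover have "(\<Sum>y\<in>UNIV. op_exp (c * t) (M i) (kdelta y) x * scheme_op M s t f y)
      = scheme_op M (ic # s) t f x"
    unfolding ic scheme_op.simps by (rule op_exp_matrix[OF M, symmetric])
  moreover have "summable (\<lambda>k. norm (\<Sum>y\<in>UNIV. \<Sum>j\<le>k. a y j * e y (k - j)))"
  proof (rule summable_comparison_test[OF _ summable_sum])
    show "summable (\<lambda>k. \<Sum>j\<le>k. norm (a y j) * norm (e y (k - j)))" for y
      by (intro summable_Cauchy_product) (use a_abs e_abs in simp_all)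
    have "norm (\<Sum>y\<in>UNIV. \<Sum>j\<le>k. a y j * e y (k - j))
        \<le> (\<Sum>y\<in>UNIV. \<Sum>j\<le>k. norm (a y j) * norm (e y (k - j)))" for k
      by (intro sum_norm_le) (simp add: abs_mult)
    then show "\<exists>N. \<forall>k\<ge>N. norm (norm (\<Sum>y\<in>UNIV. \<Sum>j\<le>k. a y j * e y (k - j)))
        \<le> (\<Sum>y\<in>UNIV. \<Sum>j\<le>k. norm (a y j) * norm (e y (k - j)))"
      by simp
  qed
  ultimately show ?case unfolding coeff by simp
qed

lemma scheme_transition_expansion:
  assumes "L1 = restriction q A1" and "L2 = restriction q A2"
  shows "(\<lambda>k. t ^ k / fact k * scheme_coeff (pair_op L1 L2) s k (kdelta y) x) sums
           scheme_transition (pair_op L1 L2) s t x y"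
  unfolding scheme_transition_def
  using scheme_op_expansion[of "pair_op L1 L2"] assms
  by (simp add: pair_op_def has_matrix_restriction)

end

theory Submission
  imports Defs
begin

text \<open>
  The relative entropy of two probability vectors lies between \<open>0\<close> and their
  \<open>\<chi>\<^sup>2\<close>-divergence \<open>\<Sum>y. (Q x y - P x y)\<^sup>2 / P x y\<close>, so it suffices to bound each summand
  by a multiple of \<open>t ^ (2 * p - k)\<close>. Let \<open>d\<close> be the distance from \<open>x\<close> to \<open>y\<close>.
  All operators involved are local, so the coefficients of \<open>P x y\<close> and of \<open>Q x y\<close> below order
  \<open>d\<close> vanish, and the coefficient of order \<open>d\<close> of \<open>P x y\<close> is positive. With \<open>n = max p d\<close>,
  the numerator is therefore \<open>O(t ^ (2 * n))\<close>, the denominator is of exact order \<open>t ^ d\<close>,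
  and \<open>2 * n - d \<ge> 2 * p - k\<close> in both cases \<open>d \<le> p\<close> and \<open>d > p\<close>.
\<close>

subsection \<open>Leading terms of exponential series\<close>

text \<open>With the zero coefficients removed, \<open>F t\<close> is \<open>t ^ n\<close> times a
  power series, and a power series is continuous at 0. The limit is one-sided because time is
  positive.\<close>

lemma exponential_series_leading_term:
  fixes a :: "nat \<Rightarrow> real"
  assumes sums: "\<And>t. (\<lambda>k. t ^ k / fact k * a k) sums F t"
    and zero: "\<And>k. k < n \<Longrightarrow> a k = 0"
  shows "((\<lambda>t. F t / t ^ n) \<longlongrightarrow> a n / fact n) (at_right 0)"
proof -
  define b where "b k = a (k + n) / fact (k + n)" for k
  define g where "g t = (\<Sum>k. b k * t ^ k)" for t
  have shifted: "(\<lambda>k. t ^ n * (b k * t ^ k)) sums F t" for t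
  proof -
    have "(\<lambda>k. t ^ (k + n) / fact (k + n) * a (k + n)) sums
        (F t - (\<Sum>k<n. t ^ k / fact k * a k))"
      using sums[of t] by (rule sums_split_initial_segment)
    moreover have "(\<Sum>k<n. t ^ k / fact k * a k) = 0"
      by (rule sum.neutral) (simp add: zero)
    ultimately show ?thesis
      by (simp add: b_def power_add mult_ac)
  qed
  have summable: "summable (\<lambda>k. b k * t ^ k)" if "t \<noteq> 0" for t
    using sums_summable[OF shifted[of t]] that by (simp add: summable_cmult_iff)
  have quotient: "F t / t ^ n = g t" if "t \<noteq> 0" for t
  proof -
    have "(\<lambda>k. t ^ n * (b k * t ^ k)) sums (t ^ n * g t)"
      unfolding g_def by (intro sums_mult summable_sums summable that)
    then have "F t = t ^ n * g t"
      using shifted sums_unique2 by blast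
    then show ?thesis
      using that by simp
  qed
  \<comment> \<open>Convergence at the nonzero point \<open>1\<close> gives a positive radius of
    convergence.\<close>
  have "isCont g 0"
    unfolding g_def by (rule isCont_powser[where K = 1]) (use summable[of 1] in auto)
  then have "(g \<longlongrightarrow> g 0) (at_right 0)"
    by (simp add: isCont_def filterlim_at_split)
  moreover have "g 0 = a n / fact n"
    unfolding g_def powser_zero by (simp add: b_def)
  moreover have "\<forall>\<^sub>F t in at_right 0. g t = F t / t ^ n"
    using eventually_at_right_less[of 0] by eventually_elim (simp add: quotient)
  ultimately show ?thesis
    using tendsto_cong[of g "\<lambda>t. F t / t ^ n" "at_right 0"] by auto
qed


subsection \<open>Positivity and conservation of mass\<close>

text \<open>Pascal's rule; this is the inductive step of the binomial expansion in
  \<open>funpow_shift\<close>.\<close>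

lemma binomial_shift_sum:
  fixes a :: "nat \<Rightarrow> real"
  shows "(\<Sum>j\<le>Suc n. real (Suc n choose j) * r ^ (Suc n - j) * a j)
    = (\<Sum>j\<le>n. real (n choose j) * r ^ (n - j) * a (Suc j))
      + r * (\<Sum>j\<le>n. real (n choose j) * r ^ (n - j) * a j)"
proof -
  have "(\<Sum>j\<le>Suc n. real (Suc n choose j) * r ^ (Suc n - j) * a j)
      = r ^ Suc n * a 0
        + (\<Sum>j\<le>n. real (Suc n choose Suc j) * r ^ (n - j) * a (Suc j))"
    by (subst sum.atMost_Suc_shift) simp
  also have "\<dots> = (\<Sum>j\<le>n. real (n choose j) * r ^ (n - j) * a (Suc j))
      + (r ^ Suc n * a 0 + (\<Sum>j\<le>n. real (n choose Suc j) * r ^ (n - j) * a (Suc j)))"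
    by (simp add: algebra_simps sum.distrib)
  also have "r ^ Suc n * a 0 + (\<Sum>j\<le>n. real (n choose Suc j) * r ^ (n - j) * a (Suc j))
      = (\<Sum>j\<le>Suc n. real (n choose j) * r ^ (Suc n - j) * a j)"
    by (subst sum.atMost_Suc_shift) simp
  \<comment> \<open>The summand \<open>j = Suc n\<close> vanishes, since
    \<open>n choose Suc n = 0\<close>.\<close>
  also have "\<dots> = r * (\<Sum>j\<le>n. real (n choose j) * r ^ (n - j) * a j)"
    by (simp add: sum_distrib_left Suc_diff_le mult_ac)
  finally show ?thesis .
qed

lemma has_matrix_funpow_add:
  assumes "has_matrix L"
  shows "(L ^^ n) (\<lambda>x. f x + r * g x) x = (L ^^ n) f x + r * (L ^^ n) g x"
  by (subst (1 2 3) has_matrix_funpow[OF assms])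
    (simp add: algebra_simps sum.distrib sum_distrib_left)

text \<open>Binomial theorem for \<open>L\<close> and multiplication by \<open>r\<close>, which
  commute since \<open>L\<close> is linear.\<close>

lemma funpow_shift:
  assumes L: "has_matrix L"
  shows "((\<lambda>f x. L f x + r * f x) ^^ n) f x
    = (\<Sum>j\<le>n. real (n choose j) * r ^ (n - j) * (L ^^ j) f x)"
proof (induction n arbitrary: f)
  case 0
  then show ?case by simp
next
  case (Suc n)
  let ?G = "\<lambda>f x. L f x + r * f x"
  have "(?G ^^ Suc n) f x = (?G ^^ n) (?G f) x"
    by (simp only: funpow_Suc_right o_apply)
  also have "\<dots> = (\<Sum>j\<le>n. real (n choose j) * r ^ (n - j) * (L ^^ j) (?G f) x)"
    by (rule Suc.IH)
  also have "\<dots> = (\<Sum>j\<le>n. real (n choose j) * r ^ (n - j) * (L ^^ Suc j) f x)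
      + r * (\<Sum>j\<le>n. real (n choose j) * r ^ (n - j) * (L ^^ j) f x)"
    by (simp add: has_matrix_funpow_add[OF L] funpow_swap1 sum.distrib sum_distrib_left
        algebra_simps)
  also have "\<dots> = (\<Sum>j\<le>Suc n. real (Suc n choose j) * r ^ (Suc n - j) * (L ^^ j) f x)"
    by (rule binomial_shift_sum[symmetric])
  finally show ?case .
qed

text \<open>The shift by \<open>r\<close> turns \<open>L\<close> into a positive operator and multiplies the
  exponential by the positive scalar \<open>exp (t * r)\<close>.\<close>

lemma op_exp_nonneg:
  assumes L: "has_matrix L"
    and shift: "\<And>f x. (\<And>z. 0 \<le> f z) \<Longrightarrow> 0 \<le> L f x + r * f x"
    and t: "0 \<le> t" and f: "\<And>z. 0 \<le> f z"
  shows "0 \<le> op_exp t L f x"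
proof -
  let ?G = "\<lambda>f x. L f x + r * f x"
  define a where "a j = t ^ j / fact j * (L ^^ j) f x" for j
  define b where "b j = (t * r) ^ j / fact j" for j
  have a: "summable (\<lambda>j. norm (a j))" "suminf a = op_exp t L f x"
    unfolding a_def[abs_def] op_exp_def
    by (rule op_exp_summable_norm[OF L]) (rule refl)
  have b: "summable (\<lambda>j. norm (b j))" "suminf b = exp (t * r)"
    using summable_norm_exp[of "t * r"]
    by (simp_all add: b_def[abs_def] exp_def divide_inverse mult.commute)
  \<comment> \<open>The Cauchy product of the series for \<open>t L\<close> and for
    \<open>exp (t * r)\<close> is, by \<open>funpow_shift\<close>, the exponential series of the
    shifted operator \<open>?G\<close>, whose terms are all nonnegative.\<close>
  have coeff: "(\<Sum>j\<le>n. a j * b (n - j)) = t ^ n / fact n * (?G ^^ n) f x" for n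
  proof -
    have "a j * b (n - j)
        = t ^ n / fact n * (real (n choose j) * r ^ (n - j) * (L ^^ j) f x)" if "j \<le> n" for j
    proof -
      have "t ^ n = t ^ j * t ^ (n - j)"
        using that by (simp flip: power_add)
      then show ?thesis
        using that by (simp add: a_def b_def binomial_fact power_mult_distrib)
    qed
    then show ?thesis
      by (simp add: funpow_shift[OF L] sum_distrib_left)
  qed
  have "0 \<le> (?G ^^ n) f z" for n z
    by (induction n arbitrary: z) (auto simp: f intro: shift)
  then have "0 \<le> (\<Sum>j\<le>n. a j * b (n - j))" for n
    unfolding coeff by (simp add: t)
  moreover have "(\<lambda>n. \<Sum>j\<le>n. a j * b (n - j)) sums (op_exp t L f x * exp (t * r))"
    using Cauchy_product_sums[OF a(1) b(1)] a(2) b(2) by simp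
  ultimately have "0 \<le> op_exp t L f x * exp (t * r)"
    by (rule sums_le[OF _ sums_zero])
  then show ?thesis
    by (simp add: zero_le_mult_iff)
qed

text \<open>The sum of all absolute rates dominates every row sum, so a single shift serves all
  states. This supplies the hypothesis \<open>shift\<close> of \<open>op_exp_nonneg\<close>.\<close>

lemma restriction_shift_nonneg:
  assumes "rates q" and f: "\<And>z. 0 \<le> f z"
  shows "0 \<le> restriction q A f x + (\<Sum>u\<in>UNIV. \<Sum>v\<in>UNIV. \<bar>q u v\<bar>) * f x"
proof -
  have "(\<Sum>v\<in>UNIV. \<bar>q x v\<bar>) \<le> (\<Sum>u\<in>UNIV. \<Sum>v\<in>UNIV. \<bar>q u v\<bar>)"
    by (rule member_le_sum) (auto intro: sum_nonneg)
  then have "(\<Sum>v\<in>UNIV. \<bar>q x v\<bar>) * f x \<le> (\<Sum>u\<in>UNIV. \<Sum>v\<in>UNIV. \<bar>q u v\<bar>) * f x"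
    by (rule mult_right_mono) (rule f)
  moreover have "- ((\<Sum>v\<in>UNIV. \<bar>q x v\<bar>) * f x) \<le> restriction q A f x"
    unfolding restriction_def sum_distrib_right sum_negf[symmetric]
  proof (rule sum_mono)
    fix v
    \<comment> \<open>The summand \<open>v = x\<close> of the restriction is zero whatever the sign
      of \<open>q x x\<close>; elsewhere the nonnegative part \<open>q x v * f v\<close> may be
      dropped.\<close>
    have "0 \<le> q x v * f v" "0 \<le> q x v" if "v \<noteq> x"
      using assms that by (auto simp: rates_def)
    then show "- (\<bar>q x v\<bar> * f x) \<le> q x v * indicator A (x, v) * (f v - f x)"
      using f[of x] by (cases "v = x") (auto simp: indicator_def algebra_simps)
  qed
  ultimately show ?thesis by linarith
qed

lemma op_exp_restriction_nonneg:
  assumes "rates q" "0 \<le> t" "\<And>z. 0 \<le> f z"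
  shows "0 \<le> op_exp t (restriction q A) f x"
  using has_matrix_restriction restriction_shift_nonneg[OF assms(1)] assms(2,3)
  by (rule op_exp_nonneg)

text \<open>Constants are annihilated, so only the term of order 0 survives.\<close>

lemma op_exp_restriction_one: "op_exp t (restriction q A) (\<lambda>x. 1) x = 1"
proof -
  have "(restriction q A ^^ n) (\<lambda>x. 1) x = (if n = 0 then 1 else 0)" for n x
    by (induction n arbitrary: x) (auto simp: restriction_def)
  then have "(\<lambda>n. t ^ n / fact n * (restriction q A ^^ n) (\<lambda>x. 1) x)
      = (\<lambda>n. if n = 0 then 1 else 0)"
    by auto
  moreover have "(\<lambda>n. if n = 0 then 1 else 0) sums (1 :: real)"
    using sums_single[of 0 "\<lambda>_. 1 :: real"] by simp
  ultimately show ?thesis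
    unfolding op_exp_def by (simp add: sums_iff)
qed

lemma op_exp_restriction_stochastic:
  "(\<Sum>y\<in>UNIV. op_exp t (restriction q A) (kdelta y) x) = 1"
  using op_exp_matrix[OF has_matrix_restriction[of q A], of t "\<lambda>x. 1" x]
  by (simp add: op_exp_restriction_one)

lemma scheme_op_nonneg:
  assumes "rates q" "\<And>i. \<exists>A. M i = restriction q A"
    and "\<And>i c. (i, c) \<in> set s \<Longrightarrow> 0 \<le> c" and "0 \<le> t" and "\<And>z. 0 \<le> f z"
  shows "0 \<le> scheme_op M s t f x"
  using assms(3)
proof (induction s arbitrary: x)
  case Nil
  then show ?case by (simp add: assms)
next
  case (Cons ic s)
  obtain i c where ic: "ic = (i, c)" by (cases ic)
  obtain A where A: "M i = restriction q A"
    using assms(2) by blast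
  show ?case
    unfolding ic scheme_op.simps A
    by (rule op_exp_restriction_nonneg) (use Cons ic assms in \<open>auto intro!: mult_nonneg_nonneg\<close>)
qed

lemma scheme_op_stochastic:
  assumes "\<And>i. \<exists>A. M i = restriction q A"
  shows "(\<Sum>y\<in>UNIV. scheme_op M s t (kdelta y) x) = 1"
proof (induction s arbitrary: x)
  case Nil
  then show ?case by (simp add: kdelta_def)
next
  case (Cons ic s)
  obtain i c where ic: "ic = (i, c)" by (cases ic)
  obtain A where A: "M i = restriction q A"
    using assms by blast
  have "(\<Sum>y\<in>UNIV. scheme_op M (ic # s) t (kdelta y) x)
      = (\<Sum>y\<in>UNIV. \<Sum>z\<in>UNIV. op_exp (c * t) (M i) (kdelta z) x * scheme_op M s t (kdelta y) z)"
    unfolding ic scheme_op.simps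
    by (intro sum.cong refl op_exp_matrix) (simp add: A has_matrix_restriction)
  also have "\<dots>
      = (\<Sum>z\<in>UNIV. \<Sum>y\<in>UNIV. op_exp (c * t) (M i) (kdelta z) x * scheme_op M s t (kdelta y) z)"
    by (rule sum.swap)
  also have "\<dots> = 1"
    by (simp add: Cons.IH op_exp_restriction_stochastic A flip: sum_distrib_left)
  finally show ?case .
qed


subsection \<open>Locality and distance\<close>

text \<open>The condition \<open>u \<noteq> v\<close> excludes the unconstrained diagonal of
  \<open>q\<close>.\<close>

definition jumps :: "('a \<Rightarrow> 'a \<Rightarrow> real) \<Rightarrow> 'a rel" where
  "jumps q = {(u, v). u \<noteq> v \<and> q u v > 0}"

text \<open>The complement of the ball of radius \<open>n\<close> for the directed distance towards
  \<open>y\<close>. Powers of \<open>jumps q\<close> replace paths, so that inductions need not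
  track distinctness of states.\<close>

definition far :: "('a \<Rightarrow> 'a \<Rightarrow> real) \<Rightarrow> 'a \<Rightarrow> nat \<Rightarrow> 'a set" where
  "far q y n = {x. \<forall>j\<le>n. (x, y) \<notin> jumps q ^^ j}"

lemma rate_eq_0_iff:
  assumes "rates q" "x \<noteq> y"
  shows "q x y = 0 \<longleftrightarrow> (x, y) \<notin> jumps q"
proof -
  have "0 \<le> q x y"
    using assms by (simp add: rates_def)
  then show ?thesis
    using assms(2) by (auto simp: jumps_def)
qed

lemma far_Suc:
  assumes "x \<in> far q y (Suc n)"
  shows "x \<in> far q y n" and "(x, z) \<in> jumps q \<Longrightarrow> z \<in> far q y n"
proof -
  show "x \<in> far q y n"
    using assms by (simp add: far_def)
  assume z: "(x, z) \<in> jumps q"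
  have "(x, y) \<in> jumps q ^^ Suc j" if "(z, y) \<in> jumps q ^^ j" for j
    using z that by (rule relpow_Suc_I2)
  then show "z \<in> far q y n"
    using assms by (force simp: far_def)
qed

text \<open>Only \<open>x\<close> and its jump targets enter, and all of these lie beyond distance
  \<open>n\<close> from \<open>y\<close>. Each application thus costs one unit of distance.\<close>

lemma restriction_vanishes_far:
  assumes "rates q" and "\<And>z. z \<in> far q y n \<Longrightarrow> f z = 0" and "x \<in> far q y (Suc n)"
  shows "restriction q A f x = 0"
  unfolding restriction_def
proof (intro sum.neutral ballI)
  fix z
  show "q x z * indicator A (x, z) * (f z - f x) = 0"
  proof (cases "(x, z) \<in> jumps q")
    case True
    then show ?thesis using assms far_Suc[OF assms(3)] by simp
  next
    case False
    then have "q x z = 0" if "z \<noteq> x"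
      using rate_eq_0_iff[OF assms(1), of x z] that by auto
    then show ?thesis by (cases "z = x") auto
  qed
qed

lemma restriction_funpow_vanishes_far:
  assumes "rates q" and "\<And>z. z \<in> far q y n \<Longrightarrow> f z = 0" and "x \<in> far q y (n + j)"
  shows "(restriction q A ^^ j) f x = 0"
  using assms(3)
proof (induction j arbitrary: x)
  case 0
  then show ?case using assms by simp
next
  case (Suc j)
  show ?case
    using restriction_vanishes_far[OF assms(1) Suc.IH] Suc.prems by simp
qed

text \<open>In the \<open>j\<close>-th summand the inner coefficient costs \<open>k - j\<close>
  units of distance and the power of \<open>M i\<close> costs \<open>j\<close>: in total
  \<open>k\<close>, whatever the split.\<close>

lemma scheme_coeff_vanishes_far:
  assumes "rates q" "\<And>i. \<exists>A. M i = restriction q A"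
    and "\<And>z. z \<in> far q y n \<Longrightarrow> f z = 0" and "x \<in> far q y (n + k)"
  shows "scheme_coeff M s k f x = 0"
  using assms(4)
proof (induction s arbitrary: k x)
  case Nil
  then show ?case using assms(3)[of x] by (cases k) simp_all
next
  case (Cons ic s)
  obtain i c where ic: "ic = (i, c)" by (cases ic)
  obtain A where A: "M i = restriction q A"
    using assms(2) by blast
  have "(M i ^^ j) (scheme_coeff M s (k - j) f) x = 0" if "j \<le> k" for j
    unfolding A
  proof (rule restriction_funpow_vanishes_far[OF assms(1) Cons.IH])
    have "n + (k - j) + j = n + k"
      using that by linarith
    then show "x \<in> far q y (n + (k - j) + j)"
      using Cons.prems by (simp only:)
  qed
  then show ?case
    by (simp add: ic)
qed

lemma kdelta_vanishes_far: "z \<in> far q y 0 \<Longrightarrow> kdelta y z = 0"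
  by (auto simp: far_def kdelta_def)

text \<open>At the order equal to the distance only shortest routes contribute, and their rates are
  positive. The diagonal part of the generator cannot interfere, since \<open>x\<close> itself is
  still too far for the previous power.\<close>

lemma generator_funpow_pos:
  assumes "rates q"
    and "(x, y) \<in> jumps q ^^ n" and "\<And>j. j < n \<Longrightarrow> (x, y) \<notin> jumps q ^^ j"
  shows "(generator q ^^ n) (kdelta y) x > 0"
  using assms(2,3)
proof (induction n arbitrary: x)
  case 0
  then show ?case by (simp add: kdelta_def)
next
  case (Suc n)
  let ?g = "(generator q ^^ n) (kdelta y)"
  have vanish: "?g z = 0" if "z \<in> far q y n" for z
    unfolding generator_eq_restriction
    by (rule restriction_funpow_vanishes_far[OF assms(1), where n = 0])
      (use that kdelta_vanishes_far in auto)
  have pos: "?g z > 0" if "(x, z) \<in> jumps q" "(z, y) \<in> jumps q ^^ n" for z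
  proof (rule Suc.IH[OF that(2)])
    fix j assume "j < n"
    then show "(z, y) \<notin> jumps q ^^ j"
      using Suc.prems(2)[of "Suc j"] relpow_Suc_I2[OF that(1)] by blast
  qed
  \<comment> \<open>A neighbour of \<open>x\<close> is at distance at least \<open>n\<close> from
    \<open>y\<close>: at exactly \<open>n\<close> the induction applies, beyond it \<open>?g\<close>
    vanishes.\<close>
  have nonneg: "?g z \<ge> 0" if "(x, z) \<in> jumps q" for z
  proof (cases "(z, y) \<in> jumps q ^^ n")
    case True
    then show ?thesis using pos that by force
  next
    case False
    have "(z, y) \<notin> jumps q ^^ j" if "j < n" for j
      using Suc.prems(2)[of "Suc j"] relpow_Suc_I2[OF \<open>(x, z) \<in> jumps q\<close>] that by blast
    then have "z \<in> far q y n"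
      using False by (auto simp: far_def le_less)
    then show ?thesis by (simp add: vanish)
  qed
  have x: "?g x = 0"
    by (rule vanish) (use Suc.prems(2) in \<open>auto simp: far_def\<close>)
  obtain z where z: "(x, z) \<in> jumps q" "(z, y) \<in> jumps q ^^ n"
    using Suc.prems(1) by (rule relpow_Suc_E2)
  have "0 < (\<Sum>v\<in>UNIV. q x v * (?g v - ?g x))"
  proof (rule sum_pos2[of _ z])
    show "0 < q x z * (?g z - ?g x)"
      using z pos[OF z] by (simp add: x jumps_def)
    show "0 \<le> q x v * (?g v - ?g x)" for v
    proof (cases "(x, v) \<in> jumps q")
      case True
      then show ?thesis using nonneg by (simp add: x jumps_def)
    next
      case False
      then show ?thesis
        using rate_eq_0_iff[OF assms(1), of x v] by (cases "v = x") auto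
    qed
  qed auto
  then show ?case
    by (simp add: generator_def[of q ?g])
qed

section \<open>Path distance in terms of powers of the jump relation\<close>

lemma is_path_imp_relpow:
  assumes "rates q" "is_path q n x y zs"
  shows "(x, y) \<in> jumps q ^^ n"
proof -
  have step: "(zs ! i, zs ! Suc i) \<in> jumps q" if "i < n" for i
  proof -
    have ne: "zs ! i \<noteq> zs ! Suc i"
      using assms(2) that by (simp add: is_path_def nth_eq_iff_index_eq)
    \<comment> \<open>The positive product only yields nonzero factors; their signs come from
      \<open>rates q\<close>.\<close>
    have "(\<Prod>i<n. q (zs ! i) (zs ! (i + 1))) \<noteq> 0"
      using assms(2) unfolding is_path_def by linarith
    then have "q (zs ! i) (zs ! Suc i) \<noteq> 0"
      using that by (auto simp: prod_zero_iff)
    then show ?thesis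
      using rate_eq_0_iff[OF assms(1) ne] by simp
  qed
  then show ?thesis
    using assms(2) unfolding relpow_fun_conv is_path_def
    by (intro exI[of _ "\<lambda>i. zs ! i"]) simp
qed

text \<open>A repeated state in a shortest walk would enclose a loop, and cutting it out would give
  a shorter walk; hence the states are distinct.\<close>

lemma shortest_relpow_imp_is_path:
  assumes "(x, y) \<in> jumps q ^^ n" and min: "\<And>j. j < n \<Longrightarrow> (x, y) \<notin> jumps q ^^ j"
  shows "\<exists>zs. is_path q n x y zs"
proof -
  obtain f where f: "f 0 = x" "f n = y" "\<And>i. i < n \<Longrightarrow> (f i, f (Suc i)) \<in> jumps q"
    using assms(1) unfolding relpow_fun_conv by blast
  have sub: "(f i, f (i + m)) \<in> jumps q ^^ m" if "i + m \<le> n" for i m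
    unfolding relpow_fun_conv by (rule exI[of _ "\<lambda>j. f (i + j)"]) (use f that in auto)
  have ne: "f i \<noteq> f j" if "i < j" "j \<le> n" for i j
  proof
    assume eq: "f i = f j"
    have "(x, f i) \<in> jumps q ^^ i" "(f j, y) \<in> jumps q ^^ (n - j)"
      using sub[of 0 i] sub[of j "n - j"] that f by auto
    then have "(x, y) \<in> jumps q ^^ (i + (n - j))"
      unfolding relpow_add eq by blast
    then show False
      using min[of "i + (n - j)"] that by linarith
  qed
  have "inj_on f {0..<n + 1}"
    by (rule linorder_inj_onI) (use ne in auto)
  then have "distinct (map f [0..<n + 1])"
    by (simp add: distinct_map del: upt_Suc)
  moreover have "(\<Prod>i<n. q (map f [0..<n + 1] ! i) (map f [0..<n + 1] ! (i + 1))) > 0"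
    by (rule prod_pos) (use f(3) in \<open>auto simp: jumps_def simp del: upt_Suc\<close>)
  ultimately have "is_path q n x y (map f [0..<n + 1])"
    unfolding is_path_def using f by (simp del: upt_Suc)
  then show ?thesis ..
qed

lemma path_dist_eq:
  assumes "rates q" and n: "(x, y) \<in> jumps q ^^ n"
    and min: "\<And>j. j < n \<Longrightarrow> (x, y) \<notin> jumps q ^^ j"
  shows "path_dist q x y = enat n"
proof (cases "x = y")
  case True
  then have "n = 0" using min[of 0] by (cases n) auto
  with True show ?thesis by (simp add: path_dist_def zero_enat_def)
next
  case False
  have "Inf {enat n |n. \<exists>zs. is_path q n x y zs} = enat n"
  proof (rule antisym)
    show "Inf {enat n |n. \<exists>zs. is_path q n x y zs} \<le> enat n"
      by (rule Inf_lower) (use shortest_relpow_imp_is_path[OF n min] in blast)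
    show "enat n \<le> Inf {enat n |n. \<exists>zs. is_path q n x y zs}"
    proof (rule Inf_greatest)
      fix e assume "e \<in> {enat n |n. \<exists>zs. is_path q n x y zs}"
      then obtain m zs where "e = enat m" "is_path q m x y zs" by blast
      then show "enat n \<le> e"
        using is_path_imp_relpow[OF assms(1)] min[of m] by (auto simp: not_less[symmetric])
    qed
  qed
  with False show ?thesis by (simp add: path_dist_def)
qed

lemma ergodic_distance:
  assumes "rates q" "ergodic q"
  obtains n where "(x, y) \<in> jumps q ^^ n" "\<And>j. j < n \<Longrightarrow> (x, y) \<notin> jumps q ^^ j"
    "path_dist q x y = enat n"
proof -
  \<comment> \<open>Self-loops do not affect the reflexive transitive closure, so irreducibility
    passes to \<open>jumps q\<close>.\<close>
  have "jumps q = {(u, v). q u v > 0} - Id"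
    by (auto simp: jumps_def)
  then have "(x, y) \<in> (jumps q)\<^sup>*"
    using assms(2) by (simp add: ergodic_def rtrancl_r_diff_Id)
  then obtain m where m: "(x, y) \<in> jumps q ^^ m"
    by (auto simp: rtrancl_power)
  define n where "n = (LEAST m. (x, y) \<in> jumps q ^^ m)"
  have "(x, y) \<in> jumps q ^^ n" "(x, y) \<notin> jumps q ^^ j" if "j < n" for j
    using m that unfolding n_def by (auto intro: LeastI dest: not_less_Least)
  moreover have "(x, y) \<in> jumps q ^^ n"
    using m unfolding n_def by (rule LeastI)
  ultimately show ?thesis
    using that path_dist_eq[OF assms(1)] by blast
qed

lemma path_dist_le_diam: "path_dist q x y \<le> path_diam q"
proof -
  have "{path_dist q x y |x y. True} = (\<lambda>(x, y). path_dist q x y) ` UNIV"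
    by auto
  then show ?thesis
    unfolding path_diam_def by (intro Max_ge) (simp_all, force)
qed


subsection \<open>Relative entropy and \<open>\<chi>\<^sup>2\<close>-divergence\<close>

text \<open>Both bounds are \<open>ln z \<le> z - 1\<close>, at \<open>z = b / a\<close> and at
  \<open>z = a / b\<close>. The linear term \<open>a - b\<close> is kept because it cancels on
  summation over vectors of equal mass.\<close>

lemma entropy_term_bounds:
  fixes a b :: real
  assumes "0 \<le> a" "0 < b"
  shows "a - b \<le> a * ln (a / b)" and "a * ln (a / b) \<le> (a - b)\<^sup>2 / b + (a - b)"
proof -
  show "a - b \<le> a * ln (a / b)"
  proof (cases "a = 0")
    case False
    with assms have "ln (b / a) \<le> b / a - 1"
      by (intro ln_le_minus_one) simp
    then have "a * ln (b / a) \<le> a * (b / a - 1)"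
      using assms by (intro mult_left_mono)
    with False assms show ?thesis
      by (simp add: ln_div algebra_simps)
  qed (use assms in simp)
  show "a * ln (a / b) \<le> (a - b)\<^sup>2 / b + (a - b)"
  proof (cases "a = 0")
    case False
    with assms have "ln (a / b) \<le> a / b - 1"
      by (intro ln_le_minus_one) simp
    then have "a * ln (a / b) \<le> a * (a / b - 1)"
      using assms by (intro mult_left_mono)
    also have "\<dots> = (a - b)\<^sup>2 / b + (a - b)"
      using assms by (simp add: field_simps power2_eq_square)
    finally show ?thesis .
  qed (use assms in \<open>simp add: power2_eq_square\<close>)
qed

lemma relative_entropy_bounds:
  fixes a b :: "'a::finite \<Rightarrow> real"
  assumes "\<And>y. 0 \<le> a y" "\<And>y. 0 < b y" "(\<Sum>y\<in>UNIV. a y) = (\<Sum>y\<in>UNIV. b y)"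
  shows "0 \<le> (\<Sum>y\<in>UNIV. a y * ln (a y / b y))"
    and "(\<Sum>y\<in>UNIV. a y * ln (a y / b y)) \<le> (\<Sum>y\<in>UNIV. (a y - b y)\<^sup>2 / b y)"
proof -
  have "(\<Sum>y\<in>UNIV. a y - b y) \<le> (\<Sum>y\<in>UNIV. a y * ln (a y / b y))"
    by (intro sum_mono entropy_term_bounds assms)
  then show "0 \<le> (\<Sum>y\<in>UNIV. a y * ln (a y / b y))"
    by (simp add: sum_subtractf assms)
  have "(\<Sum>y\<in>UNIV. a y * ln (a y / b y)) \<le> (\<Sum>y\<in>UNIV. (a y - b y)\<^sup>2 / b y + (a y - b y))"
    by (intro sum_mono entropy_term_bounds assms)
  then show "(\<Sum>y\<in>UNIV. a y * ln (a y / b y)) \<le> (\<Sum>y\<in>UNIV. (a y - b y)\<^sup>2 / b y)"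
    by (simp add: sum_subtractf sum.distrib assms)
qed

text \<open>Nonnegativity of the row entropies \<open>D x\<close> serves twice: it lets the weights
  \<open>\<mu> x\<close> be replaced by 1, and it turns the upper bound into one on the absolute
  value.\<close>

lemma rel_entropy_rate_abs_le:
  assumes "\<And>x y. 0 \<le> Q x y" "\<And>x y. 0 < P x y"
    and "\<And>x. (\<Sum>y\<in>UNIV. Q x y) = 1" "\<And>x. (\<Sum>y\<in>UNIV. P x y) = 1"
    and \<mu>: "\<And>x. 0 \<le> \<mu> x" "\<And>x. \<mu> x \<le> 1" and t: "0 < t"
  shows "\<bar>rel_entropy_rate t \<mu> Q P\<bar> \<le> (\<Sum>x\<in>UNIV. \<Sum>y\<in>UNIV. (Q x y - P x y)\<^sup>2 / P x y) / t"
proof -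
  define D where "D x = (\<Sum>y\<in>UNIV. Q x y * ln (Q x y / P x y))" for x
  have D: "0 \<le> D x" "D x \<le> (\<Sum>y\<in>UNIV. (Q x y - P x y)\<^sup>2 / P x y)" for x
    unfolding D_def using relative_entropy_bounds[of "Q x" "P x"] assms by simp_all
  have rate: "rel_entropy_rate t \<mu> Q P = (\<Sum>x\<in>UNIV. \<mu> x * D x) / t"
    by (simp add: rel_entropy_rate_def D_def sum_distrib_left mult.assoc sum_divide_distrib)
  have "\<mu> x * D x \<le> (\<Sum>y\<in>UNIV. (Q x y - P x y)\<^sup>2 / P x y)" for x
    using mult_right_mono[OF \<mu>(2)[of x] D(1)[of x]] D(2)[of x] by simp
  then have "(\<Sum>x\<in>UNIV. \<mu> x * D x) \<le> (\<Sum>x\<in>UNIV. \<Sum>y\<in>UNIV. (Q x y - P x y)\<^sup>2 / P x y)"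
    by (rule sum_mono)
  moreover have "0 \<le> (\<Sum>x\<in>UNIV. \<mu> x * D x)"
    by (intro sum_nonneg mult_nonneg_nonneg \<mu> D)
  ultimately show ?thesis
    unfolding rate using t by (simp add: divide_right_mono)
qed

text \<open>The quotient of the leading terms has order \<open>2 * n - d\<close>, and the division
  by \<open>t\<close> accounts for the \<open>- 1\<close>. Integer powers admit negative
  exponents.\<close>

lemma chi_square_term_bigo:
  fixes F G :: "real \<Rightarrow> real"
  assumes F: "((\<lambda>t. F t / t ^ n) \<longlongrightarrow> a) (at_right 0)"
    and G: "((\<lambda>t. G t / t ^ d) \<longlongrightarrow> b) (at_right 0)" "b \<noteq> 0"
    and e: "e \<le> 2 * int n - int d"
  shows "(\<lambda>t. (F t)\<^sup>2 / G t / t) \<in> O[at_right 0](\<lambda>t. t powi (e - 1))"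
proof -
  have "((\<lambda>t. (F t / t ^ n)\<^sup>2 / (G t / t ^ d)) \<longlongrightarrow> a\<^sup>2 / b) (at_right 0)"
    by (intro tendsto_intros assms)
  then have "(\<lambda>t. (F t / t ^ n)\<^sup>2 / (G t / t ^ d)) \<in> O[at_right 0](\<lambda>t. 1)"
    by (intro bigoI_tendsto[where c = "a\<^sup>2 / b"]) simp_all
  \<comment> \<open>For \<open>0 < t < 1\<close> a larger exponent gives a smaller power, so the
    inequality \<open>e\<close> suffices.\<close>
  moreover have "(\<lambda>t::real. t powi (2 * int n - int d - 1)) \<in> O[at_right 0](\<lambda>t. t powi (e - 1))"
  proof (rule bigoI[where c = 1])
    have "\<forall>\<^sub>F t in at_right (0::real). t \<in> {0<..<1}"
      by (rule eventually_at_right_real) simp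
    then show "\<forall>\<^sub>F t in at_right (0::real).
        norm (t powi (2 * int n - int d - 1)) \<le> 1 * norm (t powi (e - 1))"
    proof eventually_elim
      case (elim t)
      then have "t powi (2 * int n - int d - 1) \<le> t powi (e - 1)"
        using e by (intro power_int_decreasing) auto
      with elim show ?case by simp
    qed
  qed
  ultimately have "(\<lambda>t. (F t / t ^ n)\<^sup>2 / (G t / t ^ d) * t powi (2 * int n - int d - 1))
      \<in> O[at_right 0](\<lambda>t. 1 * t powi (e - 1))"
    by (rule landau_o.big.mult)
  moreover have "\<forall>\<^sub>F t in at_right 0.
      (F t / t ^ n)\<^sup>2 / (G t / t ^ d) * t powi (2 * int n - int d - 1) = (F t)\<^sup>2 / G t / t"
    using eventually_at_right_less[of "0::real"]
  proof eventually_elim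
    case (elim t)
    have "t powi (2 * int n - int d - 1) = (t ^ n)\<^sup>2 / t ^ d / t"
      using elim by (simp add: power_int_diff power_int_mult power2_eq_square power_mult_distrib)
    with elim show ?case
      by (simp add: power_divide)
  qed
  ultimately show ?thesis
    by (simp add: landau_o.big.in_cong)
qed

section \<open>Leading orders of the matrix entries and the resulting entropy bound\<close>

theorem theorem8p6:
  fixes q :: "'a::finite \<Rightarrow> 'a \<Rightarrow> real"
    and A1 A2 :: "('a \<times> 'a) set"
    and L L1 L2 :: "('a \<Rightarrow> real) \<Rightarrow> 'a \<Rightarrow> real"
    and s :: scheme
    and P Q :: "real \<Rightarrow> 'a \<Rightarrow> 'a \<Rightarrow> real"
    and LQ :: "nat \<Rightarrow> ('a \<Rightarrow> real) \<Rightarrow> 'a \<Rightarrow> real"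
    and \<mu> :: "real \<Rightarrow> 'a \<Rightarrow> real"
    and C :: "'a \<Rightarrow> 'a \<Rightarrow> real"
    and p k :: nat
  assumes "rates q" and "ergodic q"
    and "L = generator q"
    and "L1 = restriction q A1" and "L2 = restriction q A2"
    and "L = (\<lambda>f \<sigma>. L1 f \<sigma> + L2 f \<sigma>)"
    and "splitting_scheme s"
    and "P = transition L"
    and "Q = scheme_transition (pair_op L1 L2) s"
    and "LQ = scheme_coeff (pair_op L1 L2) s"
    and "\<And>\<Delta>t. \<Delta>t \<in> {0<..<1} \<Longrightarrow> stationary_distribution (Q \<Delta>t) (\<mu> \<Delta>t)"
    and "local_error_order L LQ p"
    and "C = commutator L LQ p"
    and "enat k = min (path_diam q) (enat p)"
    and "\<exists>\<sigma> \<sigma>'. path_dist q \<sigma> \<sigma>' = enat k \<and> C \<sigma> \<sigma>' \<noteq> 0"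
  shows "(\<lambda>\<Delta>t. rel_entropy_rate \<Delta>t (\<mu> \<Delta>t) (Q \<Delta>t) (P \<Delta>t))
           \<in> O[at_right 0](\<lambda>\<Delta>t. \<Delta>t powi (2 * int p - (int k + 1)))"
proof -
  let ?M = "pair_op L1 L2"
  have M: "\<exists>A. ?M i = restriction q A" for i
    using assms(4,5) by (auto simp: pair_op_def)
  have L: "L = restriction q UNIV"
    by (simp add: assms(3) generator_eq_restriction)
  have P_sums: "(\<lambda>j. t ^ j / fact j * (L ^^ j) (kdelta y) x) sums P t x y" for t x y
    unfolding assms(8) transition_def L by (rule op_exp_sums[OF has_matrix_restriction])
  have Q_sums: "(\<lambda>j. t ^ j / fact j * LQ j (kdelta y) x) sums Q t x y" for t x y
    unfolding assms(9,10) using assms(4,5) by (rule scheme_transition_expansion)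

  \<comment> \<open>Here \<open>d\<close> is the distance from \<open>x\<close> to \<open>y\<close>.
    The first limit is positive and fixes the exact order of the denominator; the second may be zero
    and only bounds the size of the numerator.\<close>
  have P_lim: "\<exists>b>0. ((\<lambda>t. P t x y / t ^ d) \<longlongrightarrow> b) (at_right 0)"
    and Q_lim: "\<exists>a. ((\<lambda>t. (Q t x y - P t x y) / t ^ max p d) \<longlongrightarrow> a) (at_right 0)"
    if d: "(x, y) \<in> jumps q ^^ d" "\<And>j. j < d \<Longrightarrow> (x, y) \<notin> jumps q ^^ j" for x y d
  proof -
    have far: "x \<in> far q y (0 + j)" if "j < d" for j
      using that d(2) by (simp add: far_def)
    have L_zero: "(L ^^ j) (kdelta y) x = 0" if "j < d" for j
      unfolding L using assms(1) kdelta_vanishes_far far[OF that]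
      by (rule restriction_funpow_vanishes_far)
    have LQ_zero: "LQ j (kdelta y) x = 0" if "j < d" for j
      unfolding assms(10) using assms(1) M kdelta_vanishes_far far[OF that]
      by (rule scheme_coeff_vanishes_far)
    have "(L ^^ d) (kdelta y) x / fact d > 0"
      using generator_funpow_pos[OF assms(1) d] by (simp add: assms(3))
    then show "\<exists>b>0. ((\<lambda>t. P t x y / t ^ d) \<longlongrightarrow> b) (at_right 0)"
      using exponential_series_leading_term[OF P_sums L_zero] by blast
    have QP_sums: "(\<lambda>j. t ^ j / fact j * (LQ j (kdelta y) x - (L ^^ j) (kdelta y) x))
        sums (Q t x y - P t x y)" for t
      using sums_diff[OF Q_sums P_sums] by (simp add: right_diff_distrib)
    \<comment> \<open>Below order \<open>p\<close> the coefficients agree by the choice of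
      \<open>p\<close>; below order \<open>d\<close> both vanish by locality.\<close>
    have QP_zero: "LQ j (kdelta y) x - (L ^^ j) (kdelta y) x = 0" if "j < max p d" for j
      using that L_zero LQ_zero assms(12) by (auto simp: local_error_order_def less_max_iff_disj)
    show "\<exists>a. ((\<lambda>t. (Q t x y - P t x y) / t ^ max p d) \<longlongrightarrow> a) (at_right 0)"
      using exponential_series_leading_term[OF QP_sums QP_zero] by blast
  qed

  have summand: "(\<lambda>t. (Q t x y - P t x y)\<^sup>2 / P t x y / t)
      \<in> O[at_right 0](\<lambda>t. t powi (2 * int p - int k - 1))" for x y
  proof -
    obtain d where d: "(x, y) \<in> jumps q ^^ d" "\<And>j. j < d \<Longrightarrow> (x, y) \<notin> jumps q ^^ j"
      and dist: "path_dist q x y = enat d"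
      using ergodic_distance[OF assms(1,2)] by blast
    obtain b where b: "((\<lambda>t. P t x y / t ^ d) \<longlongrightarrow> b) (at_right 0)" "b > 0"
      using P_lim[OF d] by blast
    obtain a where a: "((\<lambda>t. (Q t x y - P t x y) / t ^ max p d) \<longlongrightarrow> a) (at_right 0)"
      using Q_lim[OF d] by blast
    have "enat d \<le> path_diam q"
      using path_dist_le_diam[of q x y] by (simp add: dist)
    \<comment> \<open>If the diameter attains the minimum, then \<open>d \<le> k\<close>; otherwise
      \<open>k = p\<close>.\<close>
    then have "k \<le> p" "d \<le> k \<or> k = p"
      using assms(14) by (cases "path_diam q"; auto simp: min_def split: if_splits)+
    \<comment> \<open>For \<open>d \<le> p\<close> both alternatives give \<open>d \<le> k\<close>,
      and the right side is \<open>2 * p - d\<close>. For \<open>d > p\<close> the bound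
      \<open>k \<le> p\<close> leaves only \<open>k = p\<close>, and the right side is
      \<open>d > p = 2 * p - k\<close>.\<close>
    then have "2 * int p - int k \<le> 2 * int (max p d) - int d"
      by (auto simp: max_def)
    with a b show ?thesis
      by (intro chi_square_term_bigo) auto
  qed

  \<comment> \<open>The positive leading coefficient makes each entry positive for small
    \<open>t\<close>, as the entropy bound requires.\<close>
  have P_pos: "\<forall>\<^sub>F t in at_right 0. 0 < P t x y" for x y
  proof -
    obtain d where d: "(x, y) \<in> jumps q ^^ d" "\<And>j. j < d \<Longrightarrow> (x, y) \<notin> jumps q ^^ j"
      using ergodic_distance[OF assms(1,2)] by blast
    obtain b where "((\<lambda>t. P t x y / t ^ d) \<longlongrightarrow> b) (at_right 0)" "b > 0"
      using P_lim[OF d] by blast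
    then have "\<forall>\<^sub>F t in at_right 0. 0 < P t x y / t ^ d"
      by (rule order_tendstoD(1))
    with eventually_at_right_less[of 0] show ?thesis
      by eventually_elim (simp add: zero_less_divide_iff)
  qed
  have Q_nonneg: "0 \<le> Q t x y" if "0 \<le> t" for t x y
    unfolding assms(9) scheme_transition_def
    by (rule scheme_op_nonneg[OF assms(1) M])
      (use assms(7) that in \<open>auto simp: splitting_scheme_def kdelta_def\<close>)
  have Q_stoch: "(\<Sum>y\<in>UNIV. Q t x y) = 1" for t x
    unfolding assms(9) scheme_transition_def by (rule scheme_op_stochastic[OF M])
  have P_stoch: "(\<Sum>y\<in>UNIV. P t x y) = 1" for t x
    unfolding assms(8) transition_def L by (rule op_exp_restriction_stochastic)

  let ?X = "\<lambda>t. (\<Sum>x\<in>UNIV. \<Sum>y\<in>UNIV. (Q t x y - P t x y)\<^sup>2 / P t x y) / t"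
  \<comment> \<open>Finiteness of the state space gives one neighbourhood of 0 for all entries;
    intersecting it with \<open>t < 1\<close> makes \<open>\<mu> t\<close> a stationary
    distribution.\<close>
  have "\<forall>\<^sub>F t in at_right 0. \<forall>x y. 0 < P t x y"
    by (intro eventually_all_finite P_pos)
  moreover have "\<forall>\<^sub>F t in at_right (0::real). t \<in> {0<..<1}"
    by (rule eventually_at_right_real) simp
  ultimately have "\<forall>\<^sub>F t in at_right 0. norm (rel_entropy_rate t (\<mu> t) (Q t) (P t)) \<le> 1 * norm (?X t)"
  proof eventually_elim
    case (elim t)
    have \<mu>: "0 \<le> \<mu> t x" "(\<Sum>x\<in>UNIV. \<mu> t x) = 1" for x
      using assms(11)[OF elim(2)] by (auto simp: stationary_distribution_def)
    have "\<mu> t x \<le> 1" for x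
      using member_le_sum[of x UNIV "\<mu> t"] \<mu> by simp
    then have "\<bar>rel_entropy_rate t (\<mu> t) (Q t) (P t)\<bar> \<le> ?X t"
      by (intro rel_entropy_rate_abs_le) (use elim \<mu> Q_nonneg Q_stoch P_stoch in auto)
    then show ?case by (simp only: real_norm_def mult_1 order_trans[OF _ abs_ge_self])
  qed
  then have "(\<lambda>t. rel_entropy_rate t (\<mu> t) (Q t) (P t)) \<in> O[at_right 0](?X)"
    by (rule bigoI)
  also have "?X \<in> O[at_right 0](\<lambda>t. t powi (2 * int p - int k - 1))"
    unfolding sum_divide_distrib by (intro big_sum_in_bigo summand)
  finally show ?thesis
    by (simp add: diff_diff_eq)
qed

end
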